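(* Let $R$ be a UFD, let $I$ be a nonzero ideal of $R$, let $B=\begin{bmatrix} e&f\\ g&h\end{bmatrix}\in M_2(R)$, and suppose that its image $\widehat B=\begin{bmatrix}\hat e&\hat f\\ \hat g&\hat h\end{bmatrix}\in M_2(R/I)$ is an $I$-matrix. Then $$\mathrm{Cen}(\widehat B)=\Theta(\mathrm{Cen}(B))+\begin{bmatrix}\hat 0&\mathrm{ann}(\hat g)\cap\mathrm{ann}(\hat e-\hat h)\\ \mathrm{ann}(\hat f)\cap\mathrm{ann}(\hat e-\hat h)&\mathrm{ann}(\hat f)\cap\mathrm{ann}(\hat g)\end{bmatrix}$$ $$=\Theta(\mathrm{Cen}(B))+\begin{bmatrix}\mathrm{ann}(\hat f)\cap\mathrm{ann}(\hat g)&\mathrm{ann}(\hat g)\cap\mathrm{ann}(\hat e-\hat h)\\ \mathrm{ann}(\hat f)\cap\mathrm{ann}(\hat e-\hat h)&\hat 0\end{bmatrix}$$ $$=\Theta(\mathrm{Cen}(B))+\begin{bmatrix}\mathrm{ann}(\hat f)\cap\mathrm{ann}(\hat g)&\mathrm{ann}(\hat g)\cap\mathrm{ann}(\hat e-\hat h)\\ \mathrm{ann}(\hat f)\cap\mathrm{ann}(\hat e-\hat h)&\mathrm{ann}(\hat f)\cap\mathrm{ann}(\hat g)\end{bmatrix}.$$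
   Context: Let $k:=\gcd(I)$ be a (fixed, arbitrary) greatest common divisor in $R$ of all elements of $I$; $k\neq 0$. For $r\in R$, $\hat r$ denotes its image in $R/I$; $\Theta:M_2(R)\to M_2(R/I)$ is the entrywise natural epimorphism, and $\widehat B=\Theta(B)$. $\mathrm{Cen}(B)$ is the centralizer of $B$ in $M_2(R)$, $\mathrm{Cen}(\widehat B)$ is the centralizer of $\widehat B$ in $M_2(R/I)$, and $\mathrm{ann}(\hat r)=\{x\in R/I: x\hat r=\hat 0\}$. A $2\times 2$ array of subsets $\mathcal B,\mathcal C,\mathcal D,\mathcal E$ of $R/I$ denotes the set of all matrices whose entries lie in the corresponding subsets; an entry $\hat 0$ in such an array stands for $\{\hat 0\}$. The sum of two sets of matrices is the set of all sums. A matrix $\begin{bmatrix}\hat e&\hat f\\ \hat g&\hat h\end{bmatrix}\in M_2(R/I)$ is called an $I$-matrix if there is $t\in R$ with $t\mid k$ such that at least one of the following equalities of ideals of $R/I$ holds: $\langle\hat e-\hat h,\hat f\rangle=\langle\hat t\rangle$, or $\langle\hat e-\hat h,\hat g\rangle=\langle\hat t\rangle$, or $\langle\hat f,\hat g\rangle=\langle\hat t\rangle$. *)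

theory Defs
  imports "HOL-Algebra.Algebra"
begin

text \<open>Two-by-two matrices, entries listed row by row.\<close>

datatype 'a mat2 = Mat2 (e11: 'a) (e12: 'a) (e21: 'a) (e22: 'a)

definition M2 :: "('a, 'm) ring_scheme \<Rightarrow> 'a mat2 ring" where
  "M2 R =
    \<lparr>carrier = {A. set_mat2 A \<subseteq> carrier R},
     monoid.mult = (\<lambda>A B. Mat2
       (e11 A \<otimes>\<^bsub>R\<^esub> e11 B \<oplus>\<^bsub>R\<^esub> e12 A \<otimes>\<^bsub>R\<^esub> e21 B) (e11 A \<otimes>\<^bsub>R\<^esub> e12 B \<oplus>\<^bsub>R\<^esub> e12 A \<otimes>\<^bsub>R\<^esub> e22 B)
       (e21 A \<otimes>\<^bsub>R\<^esub> e11 B \<oplus>\<^bsub>R\<^esub> e22 A \<otimes>\<^bsub>R\<^esub> e21 B) (e21 A \<otimes>\<^bsub>R\<^esub> e12 B \<oplus>\<^bsub>R\<^esub> e22 A \<otimes>\<^bsub>R\<^esub> e22 B)),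
     one = Mat2 \<one>\<^bsub>R\<^esub> \<zero>\<^bsub>R\<^esub> \<zero>\<^bsub>R\<^esub> \<one>\<^bsub>R\<^esub>,
     ring.zero = Mat2 \<zero>\<^bsub>R\<^esub> \<zero>\<^bsub>R\<^esub> \<zero>\<^bsub>R\<^esub> \<zero>\<^bsub>R\<^esub>,
     ring.add = (\<lambda>A B. Mat2
       (e11 A \<oplus>\<^bsub>R\<^esub> e11 B) (e12 A \<oplus>\<^bsub>R\<^esub> e12 B)
       (e21 A \<oplus>\<^bsub>R\<^esub> e21 B) (e22 A \<oplus>\<^bsub>R\<^esub> e22 B))\<rparr>"

lemma Mat2_in_carrier_M2 [simp]:
  "Mat2 a b c d \<in> carrier (M2 R) \<longleftrightarrow>
    a \<in> carrier R \<and> b \<in> carrier R \<and> c \<in> carrier R \<and> d \<in> carrier R"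
  by (simp add: M2_def)

lemma M2_simps [simp]:
  "Mat2 a b c d \<otimes>\<^bsub>M2 R\<^esub> Mat2 a' b' c' d' = Mat2
     (a \<otimes>\<^bsub>R\<^esub> a' \<oplus>\<^bsub>R\<^esub> b \<otimes>\<^bsub>R\<^esub> c') (a \<otimes>\<^bsub>R\<^esub> b' \<oplus>\<^bsub>R\<^esub> b \<otimes>\<^bsub>R\<^esub> d')
     (c \<otimes>\<^bsub>R\<^esub> a' \<oplus>\<^bsub>R\<^esub> d \<otimes>\<^bsub>R\<^esub> c') (c \<otimes>\<^bsub>R\<^esub> b' \<oplus>\<^bsub>R\<^esub> d \<otimes>\<^bsub>R\<^esub> d')"
  "Mat2 a b c d \<oplus>\<^bsub>M2 R\<^esub> Mat2 a' b' c' d' =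
     Mat2 (a \<oplus>\<^bsub>R\<^esub> a') (b \<oplus>\<^bsub>R\<^esub> b') (c \<oplus>\<^bsub>R\<^esub> c') (d \<oplus>\<^bsub>R\<^esub> d')"
  "\<one>\<^bsub>M2 R\<^esub> = Mat2 \<one>\<^bsub>R\<^esub> \<zero>\<^bsub>R\<^esub> \<zero>\<^bsub>R\<^esub> \<one>\<^bsub>R\<^esub>"
  "\<zero>\<^bsub>M2 R\<^esub> = Mat2 \<zero>\<^bsub>R\<^esub> \<zero>\<^bsub>R\<^esub> \<zero>\<^bsub>R\<^esub> \<zero>\<^bsub>R\<^esub>"
  by (simp_all add: M2_def)

lemma (in ring) ring_M2: "ring (M2 R)"
proof (rule ringI)
  show "abelian_group (M2 R)"
  proof (rule abelian_groupI)
    fix x assume "x \<in> carrier (M2 R)"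
    then show "\<exists>y\<in>carrier (M2 R). y \<oplus>\<^bsub>M2 R\<^esub> x = \<zero>\<^bsub>M2 R\<^esub>"
      by (cases x) (auto intro!: bexI[where x = "map_mat2 (a_inv R) x"] simp: l_neg)
  next
    fix x y z assume "x \<in> carrier (M2 R)" "y \<in> carrier (M2 R)" "z \<in> carrier (M2 R)"
    then show "x \<oplus>\<^bsub>M2 R\<^esub> y \<oplus>\<^bsub>M2 R\<^esub> z = x \<oplus>\<^bsub>M2 R\<^esub> (y \<oplus>\<^bsub>M2 R\<^esub> z)"
      by (cases x; cases y; cases z) (simp add: a_assoc)
  next
    fix x y assume "x \<in> carrier (M2 R)" "y \<in> carrier (M2 R)"
    then show "x \<oplus>\<^bsub>M2 R\<^esub> y = y \<oplus>\<^bsub>M2 R\<^esub> x" "x \<oplus>\<^bsub>M2 R\<^esub> y \<in> carrier (M2 R)"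
      by (cases x; cases y; simp add: a_comm)+
  next
    fix x assume "x \<in> carrier (M2 R)"
    then show "\<zero>\<^bsub>M2 R\<^esub> \<oplus>\<^bsub>M2 R\<^esub> x = x" by (cases x) simp
  qed simp
  show "Group.monoid (M2 R)"
  proof (rule monoidI)
    fix x y z assume "x \<in> carrier (M2 R)" "y \<in> carrier (M2 R)" "z \<in> carrier (M2 R)"
    then show "x \<otimes>\<^bsub>M2 R\<^esub> y \<otimes>\<^bsub>M2 R\<^esub> z = x \<otimes>\<^bsub>M2 R\<^esub> (y \<otimes>\<^bsub>M2 R\<^esub> z)"
      by (cases x; cases y; cases z)
        (simp add: m_assoc r_distr l_distr a_ac)
  next
    fix x y assume "x \<in> carrier (M2 R)" "y \<in> carrier (M2 R)"
    then show "x \<otimes>\<^bsub>M2 R\<^esub> y \<in> carrier (M2 R)" by (cases x; cases y) simp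
  next
    fix x assume "x \<in> carrier (M2 R)"
    then show "\<one>\<^bsub>M2 R\<^esub> \<otimes>\<^bsub>M2 R\<^esub> x = x" "x \<otimes>\<^bsub>M2 R\<^esub> \<one>\<^bsub>M2 R\<^esub> = x" by (cases x; simp)+
  qed simp
next
  fix x y z assume "x \<in> carrier (M2 R)" "y \<in> carrier (M2 R)" "z \<in> carrier (M2 R)"
  then show "(x \<oplus>\<^bsub>M2 R\<^esub> y) \<otimes>\<^bsub>M2 R\<^esub> z = x \<otimes>\<^bsub>M2 R\<^esub> z \<oplus>\<^bsub>M2 R\<^esub> y \<otimes>\<^bsub>M2 R\<^esub> z"
    and "z \<otimes>\<^bsub>M2 R\<^esub> (x \<oplus>\<^bsub>M2 R\<^esub> y) = z \<otimes>\<^bsub>M2 R\<^esub> x \<oplus>\<^bsub>M2 R\<^esub> z \<otimes>\<^bsub>M2 R\<^esub> y"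
    by (cases x; cases y; cases z; simp add: r_distr l_distr a_ac)+
qed

definition Theta :: "('a, 'm) ring_scheme \<Rightarrow> 'a set \<Rightarrow> 'a mat2 \<Rightarrow> 'a set mat2" where
  "Theta R I = map_mat2 (\<lambda>r. I +>\<^bsub>R\<^esub> r)"

definition Cen :: "('a, 'm) monoid_scheme \<Rightarrow> 'a \<Rightarrow> 'a set" where
  "Cen G b = {x \<in> carrier G. x \<otimes>\<^bsub>G\<^esub> b = b \<otimes>\<^bsub>G\<^esub> x}"

definition ann :: "('a, 'm) ring_scheme \<Rightarrow> 'a \<Rightarrow> 'a set" where
  "ann R r = {x \<in> carrier R. x \<otimes>\<^bsub>R\<^esub> r = \<zero>\<^bsub>R\<^esub>}"

definition mat2_array :: "'a set \<Rightarrow> 'a set \<Rightarrow> 'a set \<Rightarrow> 'a set \<Rightarrow> 'a mat2 set" where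
  "mat2_array \<B> \<C> \<D> \<E> = {Mat2 b c d e | b c d e. b \<in> \<B> \<and> c \<in> \<C> \<and> d \<in> \<D> \<and> e \<in> \<E>}"

text \<open>
  The counterpart of \<^const>\<open>isgcd\<close> for an arbitrary set. Divisibility is taken in
  the full multiplicative monoid of the ring (not in \<^term>\<open>mult_of R\<close>), since the
  set may contain zero.
\<close>

definition is_gcd_of :: "('a, 'm) monoid_scheme \<Rightarrow> 'a \<Rightarrow> 'a set \<Rightarrow> bool" where
  "is_gcd_of G k A \<longleftrightarrow> k \<in> carrier G \<and> (\<forall>a\<in>A. k divides\<^bsub>G\<^esub> a) \<and>
    (\<forall>d\<in>carrier G. (\<forall>a\<in>A. d divides\<^bsub>G\<^esub> a) \<longrightarrow> d divides\<^bsub>G\<^esub> k)"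

text \<open>The argument \<^term>\<open>k\<close> is meant to be a greatest common divisor of \<^term>\<open>I\<close>.\<close>

fun I_matrix :: "('a, 'm) ring_scheme \<Rightarrow> 'a set \<Rightarrow> 'a \<Rightarrow> 'a set mat2 \<Rightarrow> bool" where
  "I_matrix R I k (Mat2 e f g h) \<longleftrightarrow>
    (\<exists>t\<in>carrier R. t divides\<^bsub>R\<^esub> k \<and>
      (Idl\<^bsub>R Quot I\<^esub> {e \<ominus>\<^bsub>R Quot I\<^esub> h, f} = Idl\<^bsub>R Quot I\<^esub> {I +>\<^bsub>R\<^esub> t} \<or>
       Idl\<^bsub>R Quot I\<^esub> {e \<ominus>\<^bsub>R Quot I\<^esub> h, g} = Idl\<^bsub>R Quot I\<^esub> {I +>\<^bsub>R\<^esub> t} \<or>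
       Idl\<^bsub>R Quot I\<^esub> {f, g} = Idl\<^bsub>R Quot I\<^esub> {I +>\<^bsub>R\<^esub> t}))"

end

theory Submission
  imports Defs
begin

text \<open>
  A matrix commutes with \<open>B\<close> iff its vector \<open>(x - w, y, z)\<close> is proportional (in the sense of a vanishing
  cross product) to \<open>(d, f, g) = (e - h, f, g)\<close>, and this condition is symmetric in the three
  coordinates; so it suffices to treat the case that \<open>t\<close> generates the ideal of
  \<open>d\<close> and \<open>f\<close> modulo \<open>I\<close>. As \<open>t\<close> divides every element of \<open>I\<close>, it divides \<open>d\<close> and \<open>f\<close>
  in \<open>R\<close>. If \<open>t = \<alpha>d + \<beta>f\<close> modulo \<open>I\<close> and \<open>(u, y, z)\<close> is proportional to \<open>(d, f, g)\<close> modulo \<open>I\<close>,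
  put \<open>s = \<alpha>u + \<beta>y\<close>. Then \<open>s(d, f, g) = t(u, y, z)\<close> modulo \<open>I\<close>, so \<open>t\<close> also
  divides \<open>sg\<close>, and \<open>(s/t)(d, f, g)\<close> is a vector over \<open>R\<close> that is exactly proportional to \<open>(d, f, g)\<close>
  and differs from \<open>(u, y, z)\<close> by elements of the required annihilators modulo \<open>I\<close>.
\<close>

section \<open>Centralizers of 2x2 matrices and proportional vectors\<close>

text \<open>The 2x2 minors of the array with rows (u, y, z) and (d, f, g) vanish. Over a commutative
  ring this is weaker than one row being a multiple of the other, but ring homomorphisms and common
  permutations of the coordinates preserve it.\<close>

definition proportional ::
    "('a, 'm) ring_scheme \<Rightarrow> 'a \<Rightarrow> 'a \<Rightarrow> 'a \<Rightarrow> 'a \<Rightarrow> 'a \<Rightarrow> 'a \<Rightarrow> bool" where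
  "proportional R u y z d f g \<longleftrightarrow>
    u \<otimes>\<^bsub>R\<^esub> f = y \<otimes>\<^bsub>R\<^esub> d \<and> u \<otimes>\<^bsub>R\<^esub> g = z \<otimes>\<^bsub>R\<^esub> d \<and> y \<otimes>\<^bsub>R\<^esub> g = z \<otimes>\<^bsub>R\<^esub> f"

lemma set_add_mat2_arrayI:
  assumes "A \<in> C" "x \<in> S1" "y \<in> S2" "z \<in> S3" "w \<in> S4"
  shows "A \<oplus>\<^bsub>G\<^esub> Mat2 x y z w \<in> C <+>\<^bsub>G\<^esub> mat2_array S1 S2 S3 S4"
  using assms unfolding set_add_def' mat2_array_def by blast

text \<open>By commutativity, the two products differ in each entry by one of the three minors up to
  sign, and both diagonal entries give the same minor. The diagonals enter only through x - w and e
  - h because scalar matrices are central.\<close>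

lemma (in cring) Mat2_in_Cen_iff:
  assumes "e \<in> carrier R" "f \<in> carrier R" "g \<in> carrier R" "h \<in> carrier R"
  shows "Mat2 x y z w \<in> Cen (M2 R) (Mat2 e f g h) \<longleftrightarrow>
    x \<in> carrier R \<and> y \<in> carrier R \<and> z \<in> carrier R \<and> w \<in> carrier R \<and>
    proportional R (x \<ominus> w) y z (e \<ominus> h) f g"
proof (cases "x \<in> carrier R \<and> y \<in> carrier R \<and> z \<in> carrier R \<and> w \<in> carrier R")
  case True
  then have c [simp]: "x \<in> carrier R" "y \<in> carrier R" "z \<in> carrier R" "w \<in> carrier R"
    by auto
  note assms [simp]
  have 1: "x \<otimes> e \<oplus> y \<otimes> g = e \<otimes> x \<oplus> f \<otimes> z \<longleftrightarrow> y \<otimes> g = z \<otimes> f"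
  proof -
    have "(x \<otimes> e \<oplus> y \<otimes> g) \<ominus> (e \<otimes> x \<oplus> f \<otimes> z) = y \<otimes> g \<ominus> z \<otimes> f"
      using c assms by algebra
    then show ?thesis by (metis r_right_minus_eq c assms m_closed a_closed)
  qed
  have 2: "x \<otimes> f \<oplus> y \<otimes> h = e \<otimes> y \<oplus> f \<otimes> w \<longleftrightarrow> (x \<ominus> w) \<otimes> f = y \<otimes> (e \<ominus> h)"
  proof -
    have "(x \<otimes> f \<oplus> y \<otimes> h) \<ominus> (e \<otimes> y \<oplus> f \<otimes> w) = (x \<ominus> w) \<otimes> f \<ominus> y \<otimes> (e \<ominus> h)"
      using c assms by algebra
    then show ?thesis by (metis r_right_minus_eq c assms m_closed a_closed minus_closed)
  qed
  have 3: "z \<otimes> e \<oplus> w \<otimes> g = g \<otimes> x \<oplus> h \<otimes> z \<longleftrightarrow> (x \<ominus> w) \<otimes> g = z \<otimes> (e \<ominus> h)"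
  proof -
    \<comment> \<open>Subtracting the sides in the opposite order gives the minor without a
      sign.\<close>
    have "(g \<otimes> x \<oplus> h \<otimes> z) \<ominus> (z \<otimes> e \<oplus> w \<otimes> g) = (x \<ominus> w) \<otimes> g \<ominus> z \<otimes> (e \<ominus> h)"
      using c assms by algebra
    then show ?thesis by (metis r_right_minus_eq c assms m_closed a_closed minus_closed)
  qed
  have 4: "z \<otimes> f \<oplus> w \<otimes> h = g \<otimes> y \<oplus> h \<otimes> w \<longleftrightarrow> y \<otimes> g = z \<otimes> f"
  proof -
    have "(g \<otimes> y \<oplus> h \<otimes> w) \<ominus> (z \<otimes> f \<oplus> w \<otimes> h) = y \<otimes> g \<ominus> z \<otimes> f"
      using c assms by algebra
    then show ?thesis by (metis r_right_minus_eq c assms m_closed a_closed)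
  qed
  show ?thesis by (auto simp: Cen_def proportional_def 1 2 3 4)
qed (auto simp: Cen_def)

lemma (in ring) Cen_M2_add_closed:
  assumes "B \<in> carrier (M2 R)" "A \<in> Cen (M2 R) B" "Y \<in> Cen (M2 R) B"
  shows "A \<oplus>\<^bsub>M2 R\<^esub> Y \<in> Cen (M2 R) B"
proof -
  interpret M: ring "M2 R" by (rule ring_M2)
  show ?thesis using assms by (simp add: Cen_def M.l_distr M.r_distr)
qed

text \<open>Every product occurring in the minors is zero: x - w kills \<open>f\<close> and
  \<open>g\<close>, \<open>y\<close> kills \<open>g\<close> and e - h, and \<open>z\<close> kills
  \<open>f\<close> and e - h.\<close>

lemma (in cring) Mat2_ann_in_Cen:
  assumes "e \<in> carrier R" "f \<in> carrier R" "g \<in> carrier R" "h \<in> carrier R"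
    and "x \<in> ann R f \<inter> ann R g" "w \<in> ann R f \<inter> ann R g"
    and "y \<in> ann R g \<inter> ann R (e \<ominus> h)" "z \<in> ann R f \<inter> ann R (e \<ominus> h)"
  shows "Mat2 x y z w \<in> Cen (M2 R) (Mat2 e f g h)"
  using assms by (auto simp: Mat2_in_Cen_iff proportional_def ann_def a_minus_def l_distr l_minus)

section \<open>Scaling proportional vectors over a commutative ring\<close>

lemma (in cring) Idl_doubletonE:
  assumes [simp]: "a \<in> carrier R" "b \<in> carrier R" and x: "x \<in> Idl {a, b}"
  obtains p q where "p \<in> carrier R" "q \<in> carrier R" "x = p \<otimes> a \<oplus> q \<otimes> b"
proof -
  have i: "ideal (PIdl a <+> PIdl b) R" by (intro add_ideals cgenideal_ideal) auto
  have "a = \<one> \<otimes> a \<oplus> \<zero> \<otimes> b" "b = \<zero> \<otimes> a \<oplus> \<one> \<otimes> b" by simp_all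
  then have "{a, b} \<subseteq> PIdl a <+> PIdl b"
    unfolding set_add_def' cgenideal_def by blast
  from genideal_minimal[OF i this] x have "x \<in> PIdl a <+> PIdl b" by blast
  then show thesis
    unfolding set_add_def' cgenideal_def using that by blast
qed

text \<open>The minors allow coordinates of the two vectors to be exchanged inside each product, so
  the combination with coefficients \<open>p\<close>, \<open>q\<close> can be moved from (u, y) to
  (d, f).\<close>

lemma (in cring) proportional_scale:
  assumes cs: "d \<in> carrier R" "f \<in> carrier R" "g \<in> carrier R" "u \<in> carrier R"
      "y \<in> carrier R" "z \<in> carrier R" and pq: "p \<in> carrier R" "q \<in> carrier R"
    and "proportional R u y z d f g"
    and t: "t = p \<otimes> d \<oplus> q \<otimes> f" and s: "s = p \<otimes> u \<oplus> q \<otimes> y"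
  shows "s \<otimes> d = t \<otimes> u" "s \<otimes> f = t \<otimes> y" "s \<otimes> g = t \<otimes> z"
proof -
  from assms have h: "u \<otimes> f = y \<otimes> d" "u \<otimes> g = z \<otimes> d" "y \<otimes> g = z \<otimes> f"
    by (auto simp: proportional_def)
  have "s \<otimes> d = p \<otimes> d \<otimes> u \<oplus> q \<otimes> (y \<otimes> d)" unfolding s
    using cs pq by algebra
  also have "\<dots> = t \<otimes> u" unfolding h(1)[symmetric] t
    using cs pq by algebra
  finally show "s \<otimes> d = t \<otimes> u" .
  have "s \<otimes> f = p \<otimes> (u \<otimes> f) \<oplus> q \<otimes> f \<otimes> y" unfolding s
    using cs pq by algebra
  also have "\<dots> = t \<otimes> y" unfolding h t
    using cs pq by algebra
  finally show "s \<otimes> f = t \<otimes> y" .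
  have "s \<otimes> g = p \<otimes> (u \<otimes> g) \<oplus> q \<otimes> (y \<otimes> g)" unfolding s
    using cs pq by algebra
  also have "\<dots> = t \<otimes> z" unfolding h t
    using cs pq by algebra
  finally show "s \<otimes> g = t \<otimes> z" .
qed

text \<open>All three differences are killed by \<open>t\<close>, hence by its multiples
  \<open>d\<close> and \<open>f\<close>. The element \<open>v\<close> stands in for the quotient of
  s g by t.\<close>

lemma (in cring) proportional_diff_ann:
  assumes c [simp]: "d' \<in> carrier R" "f' \<in> carrier R" "g \<in> carrier R" "u \<in> carrier R"
      "y \<in> carrier R" "z \<in> carrier R" "s \<in> carrier R" "t \<in> carrier R" "v \<in> carrier R"
    and d: "d = t \<otimes> d'" and f: "f = t \<otimes> f'"
    and "proportional R u y z d f g"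
    and s: "s \<otimes> d = t \<otimes> u" "s \<otimes> f = t \<otimes> y" "s \<otimes> g = t \<otimes> z" and v: "t \<otimes> v = s \<otimes> g"
  shows "u \<ominus> s \<otimes> d' \<in> ann R f \<inter> ann R g" "y \<ominus> s \<otimes> f' \<in> ann R g \<inter> ann R d"
    "z \<ominus> v \<in> ann R f \<inter> ann R d"
proof -
  from assms have h: "u \<otimes> f = y \<otimes> d" "u \<otimes> g = z \<otimes> d" "y \<otimes> g = z \<otimes> f"
    by (auto simp: proportional_def)
  have [simp]: "d \<in> carrier R" "f \<in> carrier R" unfolding d f by simp_all
  have "(u \<ominus> s \<otimes> d') \<otimes> t = t \<otimes> u \<ominus> s \<otimes> (t \<otimes> d')"
    using c by algebra
  then have 1: "(u \<ominus> s \<otimes> d') \<otimes> t = \<zero>" by (simp add: s(1) d[symmetric])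
  have "(y \<ominus> s \<otimes> f') \<otimes> t = t \<otimes> y \<ominus> s \<otimes> (t \<otimes> f')"
    using c by algebra
  then have 2: "(y \<ominus> s \<otimes> f') \<otimes> t = \<zero>" by (simp add: s(2) f[symmetric])
  have "(z \<ominus> v) \<otimes> t = t \<otimes> z \<ominus> t \<otimes> v"
    using c by algebra
  then have 3: "(z \<ominus> v) \<otimes> t = \<zero>" by (simp add: s(3) v)
  have uf: "(u \<ominus> s \<otimes> d') \<otimes> f = \<zero>" and yd: "(y \<ominus> s \<otimes> f') \<otimes> d = \<zero>"
    and zf: "(z \<ominus> v) \<otimes> f = \<zero>" and zd: "(z \<ominus> v) \<otimes> d = \<zero>"
    unfolding d f by (simp_all add: m_assoc[symmetric] 1 2 3)
  \<comment> \<open>As \<open>t\<close> need not divide \<open>g\<close>, annihilation by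
    \<open>g\<close> comes from the minors: they turn this product into z - v times
    \<open>d\<close>, which is already known to be zero. The second coordinate is treated in the
    same way with \<open>f\<close>.\<close>
  have "(u \<ominus> s \<otimes> d') \<otimes> g = u \<otimes> g \<ominus> s \<otimes> g \<otimes> d'"
    using c by algebra
  also have "\<dots> = z \<otimes> (t \<otimes> d') \<ominus> t \<otimes> v \<otimes> d'" unfolding h v d ..
  also have "\<dots> = (z \<ominus> v) \<otimes> (t \<otimes> d')"
    using c by algebra
  finally have ug: "(u \<ominus> s \<otimes> d') \<otimes> g = \<zero>" by (simp add: zd d[symmetric])
  have "(y \<ominus> s \<otimes> f') \<otimes> g = y \<otimes> g \<ominus> s \<otimes> g \<otimes> f'"
    using c by algebra
  also have "\<dots> = z \<otimes> (t \<otimes> f') \<ominus> t \<otimes> v \<otimes> f'" unfolding h v f ..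
  also have "\<dots> = (z \<ominus> v) \<otimes> (t \<otimes> f')"
    using c by algebra
  finally have yg: "(y \<ominus> s \<otimes> f') \<otimes> g = \<zero>" by (simp add: zf f[symmetric])
  show "u \<ominus> s \<otimes> d' \<in> ann R f \<inter> ann R g" "y \<ominus> s \<otimes> f' \<in> ann R g \<inter> ann R d"
    "z \<ominus> v \<in> ann R f \<inter> ann R d"
    by (simp_all add: ann_def uf ug yg yd zf zd)
qed

section \<open>Lifting proportional vectors from R/I to R\<close>

lemma (in ring) FactRing_carrierD:
  "A \<in> carrier (R Quot I) \<Longrightarrow> \<exists>r\<in>carrier R. A = I +> r"
  by (auto simp: FactRing_def A_RCOSETS_def')

text \<open>The elements a and t b differ by an element of \<open>I\<close>, and \<open>t\<close>
  divides that too; so divisibility modulo \<open>I\<close> lifts to \<open>R\<close>.\<close>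

lemma (in cring) divides_of_rcos_eq:
  assumes "ideal I R" and t: "t \<in> carrier R" and tI: "\<And>i. i \<in> I \<Longrightarrow> t divides i"
    and a: "a \<in> carrier R" and b: "b \<in> carrier R" and eq: "I +> a = I +> (t \<otimes> b)"
  shows "t divides a"
proof -
  interpret ideal I R by fact
  have "a \<ominus> t \<otimes> b \<in> I"
    using quotient_eq_iff_same_a_r_cos[OF \<open>ideal I R\<close>, of a "t \<otimes> b"] a b t eq by simp
  then obtain c where c: "c \<in> carrier R" "a \<ominus> t \<otimes> b = t \<otimes> c"
    using tI unfolding factor_def by blast
  have "a = (a \<ominus> t \<otimes> b) \<oplus> t \<otimes> b"
    using a b t by algebra
  also have "\<dots> = t \<otimes> (c \<oplus> b)" unfolding c(2)
    using c(1) b t by algebra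
  finally show ?thesis using c(1) b by (auto simp: factor_def)
qed

text \<open>Each difference is annihilated by the two coordinates of (d, f, g) at the other
  positions. This pattern survives permutations, so the case of the generators \<open>d\<close> and
  \<open>f\<close> will yield the others.\<close>

lemma (in cring) lift_proportional:
  fixes I defines "Q \<equiv> R Quot I"
  assumes I: "ideal I R" and t: "t \<in> carrier R" and tI: "\<And>i. i \<in> I \<Longrightarrow> t divides i"
    and c: "d \<in> carrier R" "f \<in> carrier R" "g \<in> carrier R" "u \<in> carrier R"
      "y \<in> carrier R" "z \<in> carrier R"
    and pr: "proportional Q (I +> u) (I +> y) (I +> z) (I +> d) (I +> f) (I +> g)"
    and gen: "Idl\<^bsub>Q\<^esub> {I +> d, I +> f} = Idl\<^bsub>Q\<^esub> {I +> t}"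
  shows "\<exists>v1 v2 v3. v1 \<in> carrier R \<and> v2 \<in> carrier R \<and> v3 \<in> carrier R \<and>
    proportional R v1 v2 v3 d f g \<and>
    I +> (u \<ominus> v1) \<in> ann Q (I +> f) \<inter> ann Q (I +> g) \<and>
    I +> (y \<ominus> v2) \<in> ann Q (I +> g) \<inter> ann Q (I +> d) \<and>
    I +> (z \<ominus> v3) \<in> ann Q (I +> f) \<inter> ann Q (I +> d)"
proof -
  interpret I: ideal I R by fact
  interpret \<pi>: ring_hom_cring R Q "(+>) I"
    unfolding Q_def by (rule I.rcos_ring_hom_cring) (rule is_cring)
  note surj = FactRing_carrierD[of _ I, folded Q_def]
  have dvd: "t divides a" if a: "a \<in> carrier R" "I +> a \<in> Idl\<^bsub>Q\<^esub> {I +> t}" for a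
  proof -
    have "I +> a \<in> PIdl\<^bsub>Q\<^esub> (I +> t)"
      using a t by (simp add: \<pi>.S.cgenideal_eq_genideal)
    then obtain b where b: "b \<in> carrier R" "I +> a = (I +> b) \<otimes>\<^bsub>Q\<^esub> (I +> t)"
      using surj by (auto simp: cgenideal_def)
    then have "I +> a = I +> (t \<otimes> b)" using t m_comm by simp
    then show ?thesis using divides_of_rcos_eq[OF I t tI] a(1) b(1) by blast
  qed
  have sub: "{I +> d, I +> f} \<subseteq> Idl\<^bsub>Q\<^esub> {I +> t}"
    unfolding gen[symmetric] using c by (intro \<pi>.S.genideal_self) auto
  obtain d' where d': "d' \<in> carrier R" "d = t \<otimes> d'"
    using dvd[of d] sub c by (auto simp: factor_def)
  obtain f' where f': "f' \<in> carrier R" "f = t \<otimes> f'"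
    using dvd[of f] sub c by (auto simp: factor_def)
  have "I +> t \<in> Idl\<^bsub>Q\<^esub> {I +> d, I +> f}"
    unfolding gen using t by (intro \<pi>.S.genideal_self') auto
  then obtain P S where "P \<in> carrier Q" "S \<in> carrier Q"
    and PS: "I +> t = P \<otimes>\<^bsub>Q\<^esub> (I +> d) \<oplus>\<^bsub>Q\<^esub> S \<otimes>\<^bsub>Q\<^esub> (I +> f)"
    using c by (elim \<pi>.S.Idl_doubletonE[rotated 2]) auto
  \<comment> \<open>The coefficients are pulled back so that \<open>s\<close> is an element of
    \<open>R\<close>: the division by \<open>t\<close> takes place there.\<close>
  then obtain p q where pq: "p \<in> carrier R" "q \<in> carrier R" "P = I +> p" "S = I +> q"
    using surj by metis
  define s where "s = p \<otimes> u \<oplus> q \<otimes> y"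
  have s: "s \<in> carrier R" using pq c by (simp add: s_def)
  have "I +> s = (I +> p) \<otimes>\<^bsub>Q\<^esub> (I +> u) \<oplus>\<^bsub>Q\<^esub> (I +> q) \<otimes>\<^bsub>Q\<^esub> (I +> y)"
    using pq c by (simp add: s_def)
  note sc = \<pi>.S.proportional_scale[OF _ _ _ _ _ _ _ _ pr PS[unfolded pq] this]
  have sQ: "(I +> s) \<otimes>\<^bsub>Q\<^esub> (I +> d) = (I +> t) \<otimes>\<^bsub>Q\<^esub> (I +> u)"
    "(I +> s) \<otimes>\<^bsub>Q\<^esub> (I +> f) = (I +> t) \<otimes>\<^bsub>Q\<^esub> (I +> y)"
    "(I +> s) \<otimes>\<^bsub>Q\<^esub> (I +> g) = (I +> t) \<otimes>\<^bsub>Q\<^esub> (I +> z)"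
    using sc pq(1,2) c by simp_all
  \<comment> \<open>Divisibility of s g by \<open>t\<close> does not come from \<open>g\<close>; it
    comes from the scaling identity modulo \<open>I\<close>. The quotient \<open>v\<close> is the
    third coordinate of the lifted vector.\<close>
  have "I +> (s \<otimes> g) = I +> (t \<otimes> z)" using sQ(3) s t c by simp
  then have "t divides s \<otimes> g" using divides_of_rcos_eq[OF I t tI] s c by simp
  then obtain v where v: "v \<in> carrier R" "s \<otimes> g = t \<otimes> v" by (auto simp: factor_def)
  have diff: "I +> (a \<ominus> b) = (I +> a) \<ominus>\<^bsub>Q\<^esub> (I +> b)"
    if "a \<in> carrier R" "b \<in> carrier R" for a b
    using that by (simp add: a_minus_def)
  have tv: "(I +> t) \<otimes>\<^bsub>Q\<^esub> (I +> v) = (I +> s) \<otimes>\<^bsub>Q\<^esub> (I +> g)"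
    using v s t c by (simp flip: \<pi>.hom_mult)
  have dQ: "I +> d = (I +> t) \<otimes>\<^bsub>Q\<^esub> (I +> d')" and fQ: "I +> f = (I +> t) \<otimes>\<^bsub>Q\<^esub> (I +> f')"
    using d' f' t by simp_all
  note an = \<pi>.S.proportional_diff_ann[OF _ _ _ _ _ _ _ _ _ dQ fQ pr sQ tv]
  have "I +> (u \<ominus> s \<otimes> d') \<in> ann Q (I +> f) \<inter> ann Q (I +> g)"
    "I +> (y \<ominus> s \<otimes> f') \<in> ann Q (I +> g) \<inter> ann Q (I +> d)"
    "I +> (z \<ominus> v) \<in> ann Q (I +> f) \<inter> ann Q (I +> d)"
    using an s t c d'(1) f'(1) v(1) by (simp_all only: diff m_closed \<pi>.hom_mult \<pi>.hom_closed)
  moreover have "proportional R (s \<otimes> d') (s \<otimes> f') v d f g"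
  proof -
    have "s \<otimes> d' \<otimes> (t \<otimes> f') = s \<otimes> f' \<otimes> (t \<otimes> d')"
      using s d'(1) f'(1) t by algebra
    \<comment> \<open>The two minors involving \<open>g\<close> are the instances x = d' and x =
      f'.\<close>
    moreover have "s \<otimes> x \<otimes> g = v \<otimes> (t \<otimes> x)" if "x \<in> carrier R" for x
    proof -
      have "s \<otimes> x \<otimes> g = s \<otimes> g \<otimes> x"
        using that s c by algebra
      also have "\<dots> = v \<otimes> (t \<otimes> x)" unfolding v(2)
        using that v(1) t by algebra
      finally show ?thesis .
    qed
    ultimately show ?thesis using d' f' by (simp add: proportional_def)
  qed
  ultimately show ?thesis using s d'(1) f'(1) v(1)
    by (intro exI[of _ "s \<otimes> d'"] exI[of _ "s \<otimes> f'"] exI[of _ v]) simp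
qed

lemma (in cring) lift_proportional_I_matrix:
  fixes I defines "Q \<equiv> R Quot I"
  assumes I: "ideal I R" and kI: "\<And>i. i \<in> I \<Longrightarrow> k divides i"
    and c: "e \<in> carrier R" "f \<in> carrier R" "g \<in> carrier R" "h \<in> carrier R"
      "u \<in> carrier R" "y \<in> carrier R" "z \<in> carrier R"
    and Im: "I_matrix R I k (Mat2 (I +> e) (I +> f) (I +> g) (I +> h))"
    and pr: "proportional Q (I +> u) (I +> y) (I +> z) (I +> (e \<ominus> h)) (I +> f) (I +> g)"
  shows "\<exists>v1 v2 v3. v1 \<in> carrier R \<and> v2 \<in> carrier R \<and> v3 \<in> carrier R \<and>
    proportional R v1 v2 v3 (e \<ominus> h) f g \<and>
    I +> (u \<ominus> v1) \<in> ann Q (I +> f) \<inter> ann Q (I +> g) \<and>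
    I +> (y \<ominus> v2) \<in> ann Q (I +> g) \<inter> ann Q (I +> (e \<ominus> h)) \<and>
    I +> (z \<ominus> v3) \<in> ann Q (I +> f) \<inter> ann Q (I +> (e \<ominus> h))"
proof -
  interpret I: ideal I R by fact
  interpret \<pi>: ring_hom_cring R Q "(+>) I"
    unfolding Q_def by (rule I.rcos_ring_hom_cring) (rule is_cring)
  define d where "d = e \<ominus> h"
  have d: "d \<in> carrier R" using c by (simp add: d_def)
  have "(I +> e) \<ominus>\<^bsub>Q\<^esub> (I +> h) = I +> d" using c by (simp add: d_def a_minus_def)
  then obtain t where t: "t \<in> carrier R" "t divides k"
    and cases: "Idl\<^bsub>Q\<^esub> {I +> d, I +> f} = Idl\<^bsub>Q\<^esub> {I +> t} \<or> Idl\<^bsub>Q\<^esub> {I +> d, I +> g} = Idl\<^bsub>Q\<^esub> {I +> t} \<or>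
      Idl\<^bsub>Q\<^esub> {I +> f, I +> g} = Idl\<^bsub>Q\<^esub> {I +> t}"
    using Im by (auto simp: Q_def)
  have tI: "t divides i" if "i \<in> I" for i
    using divides_trans[OF t(2) kI[OF that] t(1)] .
  note lift = lift_proportional[OF I t(1) tI, folded Q_def]
  note pr = pr[folded d_def]
  from cases show ?thesis
  proof (elim disjE)
    assume "Idl\<^bsub>Q\<^esub> {I +> d, I +> f} = Idl\<^bsub>Q\<^esub> {I +> t}"
    from lift[OF _ d c(2,3,5-7) pr this] show ?thesis unfolding d_def[symmetric] .
  next
    assume gen: "Idl\<^bsub>Q\<^esub> {I +> d, I +> g} = Idl\<^bsub>Q\<^esub> {I +> t}"
    \<comment> \<open>Swapping the last two coordinates puts \<open>g\<close> in the place of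
      \<open>f\<close>.\<close>
    have "proportional Q (I +> u) (I +> z) (I +> y) (I +> d) (I +> g) (I +> f)"
      using pr by (auto simp: proportional_def)
    from lift[OF _ d c(3,2,5,7,6) this gen]
    obtain v1 v3 v2 where "v1 \<in> carrier R" "v2 \<in> carrier R" "v3 \<in> carrier R"
      "proportional R v1 v3 v2 d g f"
      "I +> (u \<ominus> v1) \<in> ann Q (I +> g) \<inter> ann Q (I +> f)"
      "I +> (z \<ominus> v3) \<in> ann Q (I +> f) \<inter> ann Q (I +> d)"
      "I +> (y \<ominus> v2) \<in> ann Q (I +> g) \<inter> ann Q (I +> d)" by auto
    then show ?thesis unfolding d_def[symmetric]
      by (intro exI[of _ v1] exI[of _ v2] exI[of _ v3]) (auto simp: proportional_def)
  next
    assume gen: "Idl\<^bsub>Q\<^esub> {I +> f, I +> g} = Idl\<^bsub>Q\<^esub> {I +> t}"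
    \<comment> \<open>A cyclic rotation makes \<open>f\<close> and \<open>g\<close> the first two
      coordinates.\<close>
    have "proportional Q (I +> y) (I +> z) (I +> u) (I +> f) (I +> g) (I +> d)"
      using pr by (auto simp: proportional_def)
    from lift[OF _ c(2,3) d c(6,7,5) this gen]
    obtain v2 v3 v1 where "v1 \<in> carrier R" "v2 \<in> carrier R" "v3 \<in> carrier R"
      "proportional R v2 v3 v1 f g d"
      "I +> (y \<ominus> v2) \<in> ann Q (I +> g) \<inter> ann Q (I +> d)"
      "I +> (z \<ominus> v3) \<in> ann Q (I +> d) \<inter> ann Q (I +> f)"
      "I +> (u \<ominus> v1) \<in> ann Q (I +> g) \<inter> ann Q (I +> f)" by auto
    then show ?thesis unfolding d_def[symmetric]
      by (intro exI[of _ v1] exI[of _ v2] exI[of _ v3]) (auto simp: proportional_def)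
  qed
qed

section \<open>The centralizer in the matrix ring over R/I\<close>

theorem theorem4p1:
  fixes R :: "('a, 'm) ring_scheme" (structure)
    and I :: "'a set" and k e f g h :: 'a and B :: "'a mat2"
  assumes "factorial_domain R"
    and "ideal I R" and "I \<noteq> {\<zero>}"
    and "is_gcd_of R k I"
    and "B \<in> carrier (M2 R)" and "B = Mat2 e f g h"
    and "I_matrix R I k (Theta R I B)"
  shows
    "let Q = R Quot I;
         e' = I +> e; f' = I +> f; g' = I +> g; h' = I +> h;
         C = Theta R I ` Cen (M2 R) B;
         a = ann Q f' \<inter> ann Q g';
         b = ann Q g' \<inter> ann Q (e' \<ominus>\<^bsub>Q\<^esub> h');
         c = ann Q f' \<inter> ann Q (e' \<ominus>\<^bsub>Q\<^esub> h')
     in Cen (M2 Q) (Theta R I B) = C <+>\<^bsub>M2 Q\<^esub> mat2_array {\<zero>\<^bsub>Q\<^esub>} b c a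
      \<and> Cen (M2 Q) (Theta R I B) = C <+>\<^bsub>M2 Q\<^esub> mat2_array a b c {\<zero>\<^bsub>Q\<^esub>}
      \<and> Cen (M2 Q) (Theta R I B) = C <+>\<^bsub>M2 Q\<^esub> mat2_array a b c a"
proof -
  interpret factorial_domain R by fact
  interpret I: ideal I R by fact
  define Q where "Q = R Quot I"
  interpret \<pi>: ring_hom_cring R Q "(+>) I"
    unfolding Q_def by (rule I.rcos_ring_hom_cring) (rule is_cring)
  have c: "e \<in> carrier R" "f \<in> carrier R" "g \<in> carrier R" "h \<in> carrier R"
    using assms(5,6) by auto
  define C where "C = Theta R I ` Cen (M2 R) B"
  define a where "a = ann Q (I +> f) \<inter> ann Q (I +> g)"
  define b where "b = ann Q (I +> g) \<inter> ann Q ((I +> e) \<ominus>\<^bsub>Q\<^esub> (I +> h))"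
  define c' where "c' = ann Q (I +> f) \<inter> ann Q ((I +> e) \<ominus>\<^bsub>Q\<^esub> (I +> h))"
  have diff: "I +> (x \<ominus> y) = (I +> x) \<ominus>\<^bsub>Q\<^esub> (I +> y)"
    if "x \<in> carrier R" "y \<in> carrier R" for x y
    using that by (simp add: a_minus_def)
  have B': "Theta R I B = Mat2 (I +> e) (I +> f) (I +> g) (I +> h)"
    by (simp add: Theta_def assms(6))
  have kI: "k divides i" if "i \<in> I" for i
    using assms(4) that by (auto simp: is_gcd_of_def)
  have zero: "\<zero>\<^bsub>Q\<^esub> \<in> a"
    using c by (simp add: a_def ann_def)
  have image: "Mat2 (I +> x) (I +> y) (I +> z) (I +> w) \<in> C"
    if "x \<in> carrier R" "y \<in> carrier R" "z \<in> carrier R" "w \<in> carrier R"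
      "proportional R (x \<ominus> w) y z (e \<ominus> h) f g" for x y z w
    unfolding C_def
    by (rule image_eqI[where x = "Mat2 x y z w"])
      (use that c in \<open>auto simp: Theta_def assms(6) Mat2_in_Cen_iff\<close>)
  have C_sub: "A \<in> Cen (M2 Q) (Theta R I B)" if AC: "A \<in> C" for A
  proof -
    obtain A' where "A = Theta R I A'" "A' \<in> Cen (M2 R) B"
      using AC by (auto simp: C_def)
    then obtain x y z w where A: "A = Theta R I (Mat2 x y z w)" "Mat2 x y z w \<in> Cen (M2 R) B"
      by (cases A') auto
    then have m: "x \<in> carrier R" "y \<in> carrier R" "z \<in> carrier R" "w \<in> carrier R"
      "proportional R (x \<ominus> w) y z (e \<ominus> h) f g"
      using c by (auto simp: assms(6) Mat2_in_Cen_iff)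
    \<comment> \<open>The minors are polynomial identities, so they pass to the quotient.\<close>
    have "proportional Q (I +> (x \<ominus> w)) (I +> y) (I +> z) (I +> (e \<ominus> h)) (I +> f) (I +> g)"
      using m c unfolding proportional_def by (simp only: \<pi>.hom_mult[symmetric] minus_closed)
    then show ?thesis
      using m c unfolding B' by (simp add: A(1) Theta_def \<pi>.S.Mat2_in_Cen_iff diff)
  qed
  have sum_sub: "C <+>\<^bsub>M2 Q\<^esub> mat2_array a b c' a \<subseteq> Cen (M2 Q) (Theta R I B)"
  proof
    fix A assume "A \<in> C <+>\<^bsub>M2 Q\<^esub> mat2_array a b c' a"
    then obtain Y x y z w where "Y \<in> C" "x \<in> a" "y \<in> b" "z \<in> c'" "w \<in> a"
      and A: "A = Y \<oplus>\<^bsub>M2 Q\<^esub> Mat2 x y z w"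
      by (auto simp: set_add_def' mat2_array_def)
    then have "Mat2 x y z w \<in> Cen (M2 Q) (Theta R I B)"
      unfolding B' a_def b_def c'_def using c by (intro \<pi>.S.Mat2_ann_in_Cen) auto
    then show "A \<in> Cen (M2 Q) (Theta R I B)"
      unfolding A using C_sub \<open>Y \<in> C\<close> c by (intro \<pi>.S.Cen_M2_add_closed) (auto simp: B')
  qed
  \<comment> \<open>Since zero lies in \<open>a\<close>, the third sum contains the first two and is
    itself contained in the centralizer. It remains to place the centralizer inside both smaller
    sums.\<close>
  have mono: "C <+>\<^bsub>M2 Q\<^esub> mat2_array {\<zero>\<^bsub>Q\<^esub>} b c' a \<subseteq> C <+>\<^bsub>M2 Q\<^esub> mat2_array a b c' a"
    "C <+>\<^bsub>M2 Q\<^esub> mat2_array a b c' {\<zero>\<^bsub>Q\<^esub>} \<subseteq> C <+>\<^bsub>M2 Q\<^esub> mat2_array a b c' a"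
    using zero by (fastforce simp: set_add_def' mat2_array_def)+
  have sub: "A \<in> C <+>\<^bsub>M2 Q\<^esub> mat2_array {\<zero>\<^bsub>Q\<^esub>} b c' a \<and> A \<in> C <+>\<^bsub>M2 Q\<^esub> mat2_array a b c' {\<zero>\<^bsub>Q\<^esub>}"
    if A: "A \<in> Cen (M2 Q) (Theta R I B)" for A
  proof -
    obtain A1 A2 A3 A4 where A': "A = Mat2 A1 A2 A3 A4" by (cases A)
    have "A1 \<in> carrier Q" "A2 \<in> carrier Q" "A3 \<in> carrier Q" "A4 \<in> carrier Q"
      using A c unfolding A' B' by (auto simp: \<pi>.S.Mat2_in_Cen_iff)
    then obtain x y z w where m: "x \<in> carrier R" "y \<in> carrier R" "z \<in> carrier R" "w \<in> carrier R"
      and Axyzw: "A = Mat2 (I +> x) (I +> y) (I +> z) (I +> w)"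
      using FactRing_carrierD[of _ I, folded Q_def] A' by metis
    have "proportional Q (I +> (x \<ominus> w)) (I +> y) (I +> z) (I +> (e \<ominus> h)) (I +> f) (I +> g)"
      using A c m unfolding Axyzw B' by (simp add: \<pi>.S.Mat2_in_Cen_iff diff)
    \<comment> \<open>Lifting determines only the difference \<open>v1\<close> of the diagonal
      entries. One diagonal entry can still be chosen freely, and the two choices give the two
      arrays with a zero corner.\<close>
    then obtain v1 v2 v3 where v: "v1 \<in> carrier R" "v2 \<in> carrier R" "v3 \<in> carrier R"
      and vp: "proportional R v1 v2 v3 (e \<ominus> h) f g"
      and va: "I +> ((x \<ominus> w) \<ominus> v1) \<in> a" "I +> (y \<ominus> v2) \<in> b" "I +> (z \<ominus> v3) \<in> c'"
      using lift_proportional_I_matrix[OF assms(2) kI c minus_closed[OF m(1,4)] m(2,3)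
          assms(7)[unfolded B'], folded Q_def] c
      by (auto simp: a_def b_def c'_def diff)
    have neg: "I +> (w \<ominus> (x \<ominus> v1)) \<in> a"
    proof -
      have "w \<ominus> (x \<ominus> v1) = \<ominus> ((x \<ominus> w) \<ominus> v1)"
        using m v by algebra
      then have "I +> (w \<ominus> (x \<ominus> v1)) = \<ominus>\<^bsub>Q\<^esub> (I +> ((x \<ominus> w) \<ominus> v1))"
        using m v by simp
      then show ?thesis
        using va(1) c by (auto simp: a_def ann_def \<pi>.S.l_minus)
    qed
    have split: "I +> r = (I +> r') \<oplus>\<^bsub>Q\<^esub> (I +> (r \<ominus> r'))"
      if "r \<in> carrier R" "r' \<in> carrier R" for r r'
    proof -
      have "r = r' \<oplus> (r \<ominus> r')"
        using that by algebra
      then show ?thesis using that by (metis \<pi>.hom_add minus_closed)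
    qed
    have "x \<ominus> (x \<ominus> v1) = v1"
      using m v by algebra
    moreover have "w \<oplus> v1 \<ominus> w = v1"
      using m v by algebra
    moreover have "x \<ominus> (w \<oplus> v1) = x \<ominus> w \<ominus> v1"
      using m v by algebra
    ultimately have e: "x \<ominus> (x \<ominus> v1) = v1" "w \<oplus> v1 \<ominus> w = v1"
      "x \<ominus> (w \<oplus> v1) = x \<ominus> w \<ominus> v1" by blast+
    \<comment> \<open>First choice: keep \<open>x\<close>, which forces x - v1 in the lower right
      corner. The error there is the negative of x - w - v1, so it lies in \<open>a\<close>.\<close>
    have "Mat2 (I +> x) (I +> v2) (I +> v3) (I +> (x \<ominus> v1)) \<in> C"
      using m v vp by (intro image) (auto simp: e)
    moreover have "A = Mat2 (I +> x) (I +> v2) (I +> v3) (I +> (x \<ominus> v1)) \<oplus>\<^bsub>M2 Q\<^esub>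
        Mat2 \<zero>\<^bsub>Q\<^esub> (I +> (y \<ominus> v2)) (I +> (z \<ominus> v3)) (I +> (w \<ominus> (x \<ominus> v1)))"
      unfolding Axyzw M2_simps mat2.inject using m v by (intro conjI split) simp_all
    ultimately have 1: "A \<in> C <+>\<^bsub>M2 Q\<^esub> mat2_array {\<zero>\<^bsub>Q\<^esub>} b c' a"
      using va neg by (simp only: set_add_mat2_arrayI singletonI)
    have split': "I +> x = (I +> (w \<oplus> v1)) \<oplus>\<^bsub>Q\<^esub> (I +> (x \<ominus> w \<ominus> v1))"
      using split[of x "w \<oplus> v1"] m v unfolding e(3) by blast
    \<comment> \<open>Second choice: keep \<open>w\<close>, so that the upper left entry is w + v1
      and the error x - w - v1 moves to that corner.\<close>
    have "Mat2 (I +> (w \<oplus> v1)) (I +> v2) (I +> v3) (I +> w) \<in> C"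
      using m v vp by (intro image) (auto simp: e)
    moreover have "A = Mat2 (I +> (w \<oplus> v1)) (I +> v2) (I +> v3) (I +> w) \<oplus>\<^bsub>M2 Q\<^esub>
        Mat2 (I +> (x \<ominus> w \<ominus> v1)) (I +> (y \<ominus> v2)) (I +> (z \<ominus> v3)) \<zero>\<^bsub>Q\<^esub>"
      unfolding Axyzw M2_simps mat2.inject using m v by (intro conjI split split') simp_all
    ultimately have 2: "A \<in> C <+>\<^bsub>M2 Q\<^esub> mat2_array a b c' {\<zero>\<^bsub>Q\<^esub>}"
      using va by (simp only: set_add_mat2_arrayI singletonI)
    show ?thesis using 1 2 ..
  qed
  have "Cen (M2 Q) (Theta R I B) = C <+>\<^bsub>M2 Q\<^esub> mat2_array {\<zero>\<^bsub>Q\<^esub>} b c' a"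
    "Cen (M2 Q) (Theta R I B) = C <+>\<^bsub>M2 Q\<^esub> mat2_array a b c' {\<zero>\<^bsub>Q\<^esub>}"
    "Cen (M2 Q) (Theta R I B) = C <+>\<^bsub>M2 Q\<^esub> mat2_array a b c' a"
    using sub sum_sub mono by blast+
  then show ?thesis
    unfolding Let_def Q_def[symmetric] C_def a_def b_def c'_def by blast
qed

end
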